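(* Let $\mathcal{H}$ be a separable Hilbert space, let $K\in\mathcal{B}(\mathcal{H})$, and let $(\mathcal{X},\mathcal{Y})=(\{x_i\}_{i=1}^{\infty},\{y_i\}_{i=1}^{\infty})$ be a biframe for $\mathcal{H}$ whose biframe operator $S_{\mathcal{X},\mathcal{Y}}$ satisfies $\big(S_{\mathcal{X},\mathcal{Y}}^{1/2}\big)^{\ast}=S_{\mathcal{X},\mathcal{Y}}^{1/2}$. Then $(\mathcal{X},\mathcal{Y})$ is a $K$-biframe for $\mathcal{H}$ if and only if $K=S_{\mathcal{X},\mathcal{Y}}^{1/2}U$ for some $U\in\mathcal{B}(\mathcal{H})$.
   Context: $\mathcal{B}(\mathcal{H})$ is the set of bounded linear operators on $\mathcal{H}$. For $K\in\mathcal{B}(\mathcal{H})$, a pair $(\{x_i\}_{i=1}^{\infty},\{y_i\}_{i=1}^{\infty})$ of sequences in $\mathcal{H}$ is a $K$-biframe for $\mathcal{H}$ if there exist constants $0<A\leq B<\infty$ such that $A\|K^{\ast}x\|^2\leq\sum_{i=1}^{\infty}\langle x,x_i\rangle\langle y_i,x\rangle\leq B\|x\|^2$ for all $x\in\mathcal{H}$ (the inequalities include that the series converges to a real number). A biframe is a $K$-biframe with $K$ the identity operator. The biframe operator is $S_{\mathcal{X},\mathcal{Y}}:\mathcal{H}\to\mathcal{H}$, $S_{\mathcal{X},\mathcal{Y}}(x)=\sum_{i=1}^{\infty}\langle x,x_i\rangle y_i$, and $S_{\mathcal{X},\mathcal{Y}}^{1/2}$ denotes its square root. *)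

theory Defs
  imports "HOL-Analysis.Analysis"
begin

text \<open>
  Complex Hilbert spaces, as type classes on top of the real normed spaces of the library. The
  inner product is linear in its first argument and conjugate-linear in its second one, so that
  \<open>x \<mapsto> \<langle>x, x\<^sub>i\<rangle> y\<^sub>i\<close> is linear.
\<close>

class complex_vector = real_vector +
  fixes scaleC :: "complex \<Rightarrow> 'a \<Rightarrow> 'a"  (infixr \<open>*\<^sub>C\<close> 75)
  assumes scaleC_add_right: "a *\<^sub>C (x + y) = a *\<^sub>C x + a *\<^sub>C y"
    and scaleC_add_left: "(a + b) *\<^sub>C x = a *\<^sub>C x + b *\<^sub>C x"
    and scaleC_scaleC: "a *\<^sub>C b *\<^sub>C x = (a * b) *\<^sub>C x"
    and scaleC_of_real: "complex_of_real r *\<^sub>C x = r *\<^sub>R x"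

text \<open>
  Positive definiteness of the inner product is contained in the last axiom of the next class.
\<close>

class complex_inner = complex_vector + real_normed_vector +
  fixes cinner :: "'a \<Rightarrow> 'a \<Rightarrow> complex"
  assumes cinner_commute: "cinner x y = cnj (cinner y x)"
    and cinner_add_left: "cinner (x + y) z = cinner x z + cinner y z"
    and cinner_scaleC_left: "cinner (c *\<^sub>C x) y = c * cinner x y"
    and cinner_self: "cinner x x = complex_of_real ((norm x)\<^sup>2)"

class chilbert_space = complex_inner + complete_space

instantiation complex :: chilbert_space
begin

definition scaleC_complex :: "complex \<Rightarrow> complex \<Rightarrow> complex" where
  "scaleC_complex c x = c * x"

definition cinner_complex :: "complex \<Rightarrow> complex \<Rightarrow> complex" where
  "cinner_complex x y = x * cnj y"

instance
  by standard
    (simp_all add: scaleC_complex_def cinner_complex_def algebra_simps scaleR_conv_of_real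
      complex_norm_square[symmetric])

end

subclass (in chilbert_space) banach ..

definition bounded_clinear :: "('a::complex_inner \<Rightarrow> 'b::complex_inner) \<Rightarrow> bool" where
  "bounded_clinear T \<longleftrightarrow> bounded_linear T \<and> (\<forall>c x. T (c *\<^sub>C x) = c *\<^sub>C T x)"

text \<open>
  The description is proper for every bounded operator between Hilbert spaces. It is only used
  there.
\<close>

definition cadjoint :: "('a::chilbert_space \<Rightarrow> 'b::chilbert_space) \<Rightarrow> 'b \<Rightarrow> 'a" where
  "cadjoint T = (THE T'. \<forall>x y. cinner (T x) y = cinner x (T' y))"

definition positive_operator :: "('a::complex_inner \<Rightarrow> 'a) \<Rightarrow> bool" where
  "positive_operator T \<longleftrightarrow>
     bounded_clinear T \<and> (\<forall>x. cinner (T x) x \<in> \<real> \<and> 0 \<le> Re (cinner (T x) x))"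

text \<open>
  The square root of an operator is its positive square root. A positive operator on a complex
  Hilbert space has exactly one, and the biframe operator of a biframe is positive.
\<close>

definition operator_sqrt :: "('a::complex_inner \<Rightarrow> 'a) \<Rightarrow> 'a \<Rightarrow> 'a" where
  "operator_sqrt S = (THE R. positive_operator R \<and> R \<circ> R = S)"

text \<open>
  Sequences are indexed from \<open>0\<close>, and series converge in the order of the index. The witness
  \<open>s\<close> says that the complex series converges to a real number.
\<close>

definition K_biframe ::
    "('a::chilbert_space \<Rightarrow> 'a) \<Rightarrow> (nat \<Rightarrow> 'a) \<Rightarrow> (nat \<Rightarrow> 'a) \<Rightarrow> bool" where
  "K_biframe K X Y \<longleftrightarrow>
     (\<exists>A B::real. 0 < A \<and> A \<le> B \<and>
       (\<forall>x. \<exists>s::real.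
          (\<lambda>i. cinner x (X i) * cinner (Y i) x) sums complex_of_real s \<and>
          A * (norm (cadjoint K x))\<^sup>2 \<le> s \<and> s \<le> B * (norm x)\<^sup>2))"

definition biframe :: "(nat \<Rightarrow> 'a::chilbert_space) \<Rightarrow> (nat \<Rightarrow> 'a) \<Rightarrow> bool" where
  "biframe X Y \<longleftrightarrow> K_biframe id X Y"

text \<open>
  \<open>S\<close> is the biframe operator of \<open>(X, Y)\<close>: the defining series converges in norm at every point,
  with sum \<open>S x\<close>. By uniqueness of limits there is at most one such \<open>S\<close>.
\<close>

definition is_biframe_operator ::
    "(nat \<Rightarrow> 'a::complex_inner) \<Rightarrow> (nat \<Rightarrow> 'a) \<Rightarrow> ('a \<Rightarrow> 'a) \<Rightarrow> bool" where
  "is_biframe_operator X Y S \<longleftrightarrow> (\<forall>x. (\<lambda>i. cinner x (X i) *\<^sub>C Y i) sums S x)"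

end

theory Submission
  imports Defs
begin

text \<open>
  Both sides of the equivalence hold for every bounded \<open>K\<close>, because the biframe operator of a
  biframe is invertible.

  The biframe inequalities say that \<open>A I \<le> S \<le> B I\<close> with \<open>0 < A\<close>, since
  \<open>\<langle>S x, x\<rangle> = \<Sum>\<^sub>i \<langle>x, x\<^sub>i\<rangle> \<langle>y\<^sub>i, x\<rangle>\<close>. Put \<open>T = I - S/B\<close> and \<open>q = 1 - A/B\<close>; then
  \<open>0 \<le> T \<le> q I\<close>, hence \<open>\<parallel>T\<parallel> \<le> q < 1\<close> (\<open>norm_le_if_between\<close>). So \<open>S = B (I - T)\<close> is onto, by the
  contraction principle (\<open>surj_if_coercive\<close>).

  The same principle gives the square root. The equation \<open>(I - Z)\<^sup>2 = I - T\<close> reads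
  \<open>Z = (T + Z\<^sup>2)/2\<close>, and \<open>Z \<mapsto> (T + Z\<^sup>2)/2\<close> is a \<open>q\<close>-contraction of the ball of radius \<open>q\<close> in the
  Banach space of bounded operators. Its fixed point \<open>Z\<close> is selfadjoint (\<open>quadratic_fixed_point\<close>),
  and \<open>\<surd>B (I - Z)\<close> is a positive square root of \<open>S\<close> (\<open>coercive_sqrt\<close>).
  If \<open>P\<close> is any positive square root, then
  \<open>0 \<le> P \<le> \<surd>B I\<close>, so \<open>W = I - P/\<surd>B\<close> satisfies \<open>\<parallel>W\<parallel> \<le> 1\<close> and the same equation, and
  \<open>W - Z = (W (W - Z) + (W - Z) Z)/2\<close> forces \<open>W = Z\<close> (\<open>quadratic_fixed_point_unique\<close>). No
  commutation argument is needed.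

  The square root \<open>R\<close> is onto because \<open>R \<circ> R = S\<close> is, and \<open>A \<parallel>x\<parallel>\<^sup>2 \<le> \<langle>S x, x\<rangle> = \<parallel>R x\<parallel>\<^sup>2\<close>. So \<open>R\<close> has
  a bounded inverse, and \<open>U = R\<^sup>-\<^sup>1 K\<close> is the factor (\<open>factor_through\<close>). On the other side,
  \<open>\<parallel>K\<^sup>* x\<parallel> \<le> M \<parallel>x\<parallel>\<close> turns the lower biframe bound \<open>A\<close> into the lower \<open>K\<close>-bound \<open>A / (M\<^sup>2 + 1)\<close>;
  here the existence of \<open>K\<^sup>*\<close> rests on the Riesz representation theorem.
\<close>

section \<open>Complex inner products\<close>

lemma scaleC_scaleR: "c *\<^sub>C (r *\<^sub>R x) = r *\<^sub>R (c *\<^sub>C (x :: 'a::complex_vector))"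
  by (simp add: scaleC_of_real[symmetric] scaleC_scaleC mult.commute)

lemma scaleC_diff_right: "c *\<^sub>C (x - y) = c *\<^sub>C x - c *\<^sub>C (y :: 'a::complex_vector)"
  by (metis add_diff_cancel_right' diff_add_cancel scaleC_add_right)

lemma cinner_add_right: "cinner x (y + z) = cinner x y + cinner x (z :: 'a::complex_inner)"
  by (metis cinner_add_left cinner_commute complex_cnj_add)

lemma cinner_scaleC_right: "cinner x (c *\<^sub>C y) = cnj c * cinner x (y :: 'a::complex_inner)"
  by (metis cinner_scaleC_left cinner_commute complex_cnj_mult)

lemma cinner_scaleR_left: "cinner (r *\<^sub>R x) y = r *\<^sub>R cinner x (y :: 'a::complex_inner)"
  using cinner_scaleC_left[of "of_real r" x y] by (simp add: scaleC_of_real scaleR_conv_of_real)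

lemma cinner_scaleR_right: "cinner x (r *\<^sub>R y) = r *\<^sub>R cinner x (y :: 'a::complex_inner)"
  using cinner_scaleC_right[of x "of_real r" y] by (simp add: scaleC_of_real scaleR_conv_of_real)

lemma norm_add_sq:
  "(norm (x + y :: 'a::complex_inner))\<^sup>2 = (norm x)\<^sup>2 + 2 * Re (cinner x y) + (norm y)\<^sup>2"
proof -
  have "Re (cinner (x + y) (x + y)) = Re (cinner x x) + 2 * Re (cinner x y) + Re (cinner y y)"
    using cinner_commute[of y x] by (simp add: cinner_add_left cinner_add_right)
  then show ?thesis by (simp add: cinner_self)
qed

lemma norm_scaleC: "norm (c *\<^sub>C x) = cmod c * norm (x :: 'a::complex_inner)"
proof -
  have "complex_of_real ((norm (c *\<^sub>C x))\<^sup>2) = c * cnj c * of_real ((norm x)\<^sup>2)"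
    by (simp only: cinner_self[symmetric] cinner_scaleC_left cinner_scaleC_right ac_simps)
  also have "\<dots> = complex_of_real ((cmod c * norm x)\<^sup>2)"
    by (simp only: complex_norm_square[symmetric] of_real_mult[symmetric] power_mult_distrib)
  finally have "complex_of_real ((norm (c *\<^sub>C x))\<^sup>2) = complex_of_real ((cmod c * norm x)\<^sup>2)" .
  then have "(norm (c *\<^sub>C x))\<^sup>2 = (cmod c * norm x)\<^sup>2"
    by (simp only: of_real_eq_iff)
  then show ?thesis by (simp add: power2_eq_iff_nonneg)
qed

lemma bounded_linear_scaleC: "bounded_linear (\<lambda>x :: 'a::complex_inner. c *\<^sub>C x)"
  by (rule bounded_linear_intro[where K = "cmod c"])
     (simp_all add: scaleC_add_right scaleC_scaleR norm_scaleC)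

lemma cinner_Cauchy_Schwarz: "cmod (cinner x y) \<le> norm x * norm (y :: 'a::complex_inner)"
proof (cases "norm y = 0")
  case True
  then have "y = 0 *\<^sub>R y" by simp
  then have "cinner x y = 0" using cinner_scaleR_right[of x 0 y] by simp
  then show ?thesis by simp
next
  case False
  \<comment> \<open>This coefficient minimises \<open>\<parallel>x + c y\<parallel>\<close>.\<close>
  define c where "c = - cinner x y / of_real ((norm y)\<^sup>2)"
  have "cinner x (c *\<^sub>C y) = - of_real ((cmod (cinner x y))\<^sup>2 / (norm y)\<^sup>2)"
    using complex_norm_square[of "cinner x y"]
    by (simp add: c_def cinner_scaleC_right mult.commute)
  then have 1: "Re (cinner x (c *\<^sub>C y)) = - ((cmod (cinner x y))\<^sup>2 / (norm y)\<^sup>2)"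
    by (simp only: uminus_complex.sel Re_complex_of_real)
  have 2: "(norm (c *\<^sub>C y))\<^sup>2 = (cmod (cinner x y))\<^sup>2 / (norm y)\<^sup>2"
    using False
    by (simp add: norm_scaleC c_def norm_divide power_mult_distrib power_divide norm_power
        field_simps)
  have "0 \<le> (norm (x + c *\<^sub>C y))\<^sup>2" by simp
  then have "(cmod (cinner x y))\<^sup>2 / (norm y)\<^sup>2 \<le> (norm x)\<^sup>2"
    unfolding norm_add_sq 1 2 by simp
  then have "(cmod (cinner x y))\<^sup>2 \<le> (norm x * norm y)\<^sup>2"
    using False by (simp add: power_mult_distrib divide_le_eq)
  then show ?thesis by (rule power2_le_imp_le) simp
qed

lemma bounded_bilinear_cinner:
  "bounded_bilinear (cinner :: 'a::complex_inner \<Rightarrow> 'a \<Rightarrow> complex)"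
proof
  show "\<exists>K. \<forall>a b :: 'a. norm (cinner a b) \<le> norm a * norm b * K"
    by (intro exI[of _ 1]) (simp add: cinner_Cauchy_Schwarz)
qed (simp_all add: cinner_add_left cinner_add_right cinner_scaleR_left cinner_scaleR_right)

interpretation cinner: bounded_bilinear "cinner :: 'a::complex_inner \<Rightarrow> 'a \<Rightarrow> complex"
  by (rule bounded_bilinear_cinner)

lemma cinner_ext:
  assumes "\<And>x. cinner x y = cinner x (z :: 'a::complex_inner)"
  shows "y = z"
proof -
  have "cinner (y - z) (y - z) = 0"
    using assms by (simp add: cinner.diff_right)
  then show ?thesis by (simp add: cinner_self)
qed

section \<open>Riesz representation and adjoints\<close>

lemma quadratic_nonneg_imp_linear_term_zero:
  fixes a b :: real
  assumes "0 \<le> a" and "\<And>t. 0 \<le> t\<^sup>2 * a + 2 * t * b"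
  shows "b = 0"
proof (rule ccontr)
  assume "b \<noteq> 0"
  define k where "k = b / (a + 1)"
  have b: "b = k * (a + 1)" using \<open>0 \<le> a\<close> by (simp add: k_def)
  have "0 \<le> (- k)\<^sup>2 * a + 2 * (- k) * b" by (rule assms(2))
  also have "\<dots> = - (k\<^sup>2 * (a + 2))" by (simp add: b power2_eq_square algebra_simps)
  also have "\<dots> < 0" using \<open>0 \<le> a\<close> \<open>b \<noteq> 0\<close> b by auto
  finally show False by simp
qed

text \<open>
  The representing vector is the minimiser of \<open>\<parallel>x\<parallel>\<^sup>2 - 2 Re (f x)\<close>. It exists because the
  parallelogram law makes every minimising sequence a Cauchy sequence.
\<close>

lemma Riesz_representation:
  fixes f :: "'a::chilbert_space \<Rightarrow> complex"
  assumes f: "bounded_linear f" and fC: "\<And>c x. f (c *\<^sub>C x) = c * f x"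
  shows "\<exists>u. \<forall>x. f x = cinner x u"
proof -
  interpret f: bounded_linear f by (rule f)
  define \<phi> where "\<phi> x = (norm x)\<^sup>2 - 2 * Re (f x)" for x
  obtain M where M: "\<And>x. norm (f x) \<le> norm x * M" using f.bounded by blast
  have \<phi>_lower: "- M\<^sup>2 \<le> \<phi> x" for x
  proof -
    have "Re (f x) \<le> norm x * M" using M[of x] complex_Re_le_cmod[of "f x"] by linarith
    moreover have "0 \<le> (norm x - M)\<^sup>2" by simp
    ultimately show ?thesis by (simp add: \<phi>_def power2_diff)
  qed
  define m where "m = Inf (range \<phi>)"
  have bdd: "bdd_below (range \<phi>)" using \<phi>_lower by (auto intro!: bdd_belowI)
  have m_le: "m \<le> \<phi> x" for x unfolding m_def by (rule cInf_lower[OF _ bdd]) simp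
  have "\<exists>x. \<phi> x < m + 1 / real (Suc n)" for n
    using cInf_lessD[of "range \<phi>" "m + 1 / real (Suc n)"] unfolding m_def by auto
  then obtain u where u: "\<And>n. \<phi> (u n) < m + 1 / real (Suc n)" by metis
  have para: "(norm (x - y))\<^sup>2 \<le> 2 * (\<phi> x - m) + 2 * (\<phi> y - m)" for x y
  proof -
    have "(norm (x - y))\<^sup>2 + (norm (x + y))\<^sup>2 = 2 * (norm x)\<^sup>2 + 2 * (norm y)\<^sup>2"
      using norm_add_sq[of x "- y"] norm_add_sq[of x y] by (simp add: cinner.minus_right)
    moreover have "\<phi> ((1/2) *\<^sub>R (x + y)) = (norm (x + y))\<^sup>2 / 4 - Re (f x) - Re (f y)"
      unfolding \<phi>_def f.scaleR f.add norm_scaleR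
      by (simp add: power_divide power_mult_distrib add_divide_distrib)
    ultimately show ?thesis using m_le[of "(1/2) *\<^sub>R (x + y)"] by (simp add: \<phi>_def)
  qed
  have "Cauchy u"
  proof (rule metric_CauchyI)
    fix e :: real assume "0 < e"
    define d where "d = e\<^sup>2 / 4"
    have "0 < d" and e: "e\<^sup>2 = 4 * d" using \<open>0 < e\<close> by (simp_all add: d_def)
    then obtain N where N: "1 / real (Suc N) < d"
      using reals_Archimedean[of d] by (auto simp: inverse_eq_divide)
    have small: "\<phi> (u k) - m < d" if "N \<le> k" for k
    proof -
      have "1 / real (Suc k) \<le> 1 / real (Suc N)" using that by (simp add: field_simps)
      then show ?thesis using u[of k] N by linarith
    qed
    have "dist (u j) (u k) < e" if "N \<le> j" "N \<le> k" for j k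
    proof -
      have "(norm (u j - u k))\<^sup>2 \<le> 2 * (\<phi> (u j) - m) + 2 * (\<phi> (u k) - m)" by (rule para)
      also have "\<dots> < 2 * d + 2 * d"
        by (intro add_strict_mono mult_strict_left_mono small that) auto
      finally have "(norm (u j - u k))\<^sup>2 < e\<^sup>2" by (simp add: e)
      then show ?thesis using \<open>0 < e\<close> by (simp add: dist_norm power2_less_imp_less)
    qed
    then show "\<exists>N. \<forall>j\<ge>N. \<forall>k\<ge>N. dist (u j) (u k) < e" by blast
  qed
  then obtain v where v: "u \<longlonglongrightarrow> v" using Cauchy_convergent convergent_def by blast
  have "(\<lambda>n. \<phi> (u n)) \<longlonglongrightarrow> \<phi> v"
    unfolding \<phi>_def by (intro tendsto_intros f.tendsto v)
  moreover have "(\<lambda>n. m + 1 / real (Suc n)) \<longlonglongrightarrow> m + 0"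
    by (intro tendsto_intros LIMSEQ_Suc[OF lim_1_over_n])
  ultimately have "\<phi> v \<le> m + 0"
    by (rule LIMSEQ_le) (use u less_imp_le in blast)
  then have "\<phi> v \<le> m" by simp
  have Re_eq: "Re (f x) = Re (cinner x v)" for x
  proof -
    have "Re (cinner v x) - Re (f x) = 0"
    proof (rule quadratic_nonneg_imp_linear_term_zero)
      show "0 \<le> (norm x)\<^sup>2" by simp
      fix t :: real
      have "\<phi> v \<le> \<phi> (v + t *\<^sub>R x)" using \<open>\<phi> v \<le> m\<close> m_le order_trans by blast
      then show "0 \<le> t\<^sup>2 * (norm x)\<^sup>2 + 2 * t * (Re (cinner v x) - Re (f x))"
        by (simp add: \<phi>_def norm_add_sq f.add f.scaleR cinner_scaleR_right power_mult_distrib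
            algebra_simps)
    qed
    then show ?thesis using cinner_commute[of v x] by simp
  qed
  \<comment> \<open>By complex homogeneity, the real part at \<open>\<i> x\<close> gives the imaginary part at \<open>x\<close>.\<close>
  have "f x = cinner x v" for x
  proof (rule complex_eqI)
    show "Im (f x) = Im (cinner x v)"
      using Re_eq[of "\<i> *\<^sub>C x"] by (simp add: fC cinner_scaleC_left)
  qed (rule Re_eq)
  then show ?thesis by blast
qed

lemma cinner_cadjoint:
  fixes T :: "'a::chilbert_space \<Rightarrow> 'b::chilbert_space"
  assumes "bounded_clinear T"
  shows "cinner (T x) y = cinner x (cadjoint T y)"
proof -
  have bl: "bounded_linear T" and C: "\<And>c x. T (c *\<^sub>C x) = c *\<^sub>C T x"
    using assms by (auto simp: bounded_clinear_def)
  have "\<exists>u. \<forall>x. cinner (T x) y = cinner x u" for y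
    by (rule Riesz_representation)
       (simp_all add: C cinner_scaleC_left bounded_linear_compose[OF cinner.bounded_linear_left bl])
  then obtain T' where T': "\<And>x y. cinner (T x) y = cinner x (T' y)" by metis
  have "cadjoint T = T'"
    unfolding cadjoint_def
  proof (rule the_equality)
    fix T'' assume T'': "\<forall>x y. cinner (T x) y = cinner x (T'' y)"
    show "T'' = T'"
    proof
      fix y show "T'' y = T' y"
        by (rule cinner_ext) (metis T' T'')
    qed
  qed (simp add: T')
  then show ?thesis by (simp add: T')
qed

lemma cadjoint_id: "cadjoint (id :: 'a::chilbert_space \<Rightarrow> 'a) = id"
proof
  have id: "bounded_clinear (id :: 'a \<Rightarrow> 'a)"
    by (simp add: bounded_clinear_def id_def bounded_linear_ident)
  show "cadjoint id y = id y" for y :: 'a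
    by (rule cinner_ext) (simp add: cinner_cadjoint[OF id, symmetric])
qed

lemma norm_cadjoint_le:
  fixes T :: "'a::chilbert_space \<Rightarrow> 'b::chilbert_space"
  assumes T: "bounded_clinear T" and M: "0 \<le> M" "\<And>x. norm (T x) \<le> M * norm x"
  shows "norm (cadjoint T y) \<le> M * norm y"
proof (cases "cadjoint T y = 0")
  case True
  then show ?thesis using \<open>0 \<le> M\<close> by simp
next
  case False
  define z where "z = cadjoint T y"
  have "(norm z)\<^sup>2 = cmod (cinner (T z) y)"
    by (simp add: cinner_cadjoint[OF T] z_def cinner_self norm_power)
  also have "\<dots> \<le> norm (T z) * norm y" by (rule cinner_Cauchy_Schwarz)
  also have "\<dots> \<le> M * norm z * norm y" by (intro mult_right_mono M) simp
  finally have "norm z * norm z \<le> norm z * (M * norm y)"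
    by (simp add: power2_eq_square ac_simps)
  then show ?thesis
    using False by (simp add: z_def)
qed

section \<open>Numerical bounds for operators\<close>

text \<open>
  \<open>op_between a b T\<close> means \<open>a I \<le> T \<le> b I\<close> for a linear operator \<open>T\<close>. Boundedness is not
  demanded: it is a consequence.
\<close>

definition op_between :: "real \<Rightarrow> real \<Rightarrow> ('a::complex_inner \<Rightarrow> 'a) \<Rightarrow> bool" where
  "op_between a b T \<longleftrightarrow>
     (\<forall>x y. T (x + y) = T x + T y) \<and> (\<forall>c x. T (c *\<^sub>C x) = c *\<^sub>C T x) \<and>
     (\<forall>x. cinner (T x) x \<in> \<real> \<and>
        a * (norm x)\<^sup>2 \<le> Re (cinner (T x) x) \<and> Re (cinner (T x) x) \<le> b * (norm x)\<^sup>2)"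

text \<open>Polarisation: an operator on a complex space with real quadratic form is symmetric.\<close>

lemma op_between_symmetric:
  assumes "op_between a b T"
  shows "cinner (T x) y = cinner x (T y)"
proof -
  have add: "\<And>x y. T (x + y) = T x + T y" and C: "\<And>c x. T (c *\<^sub>C x) = c *\<^sub>C T x"
    and real: "\<And>x. cinner (T x) x \<in> \<real>"
    using assms by (auto simp: op_between_def)
  define h where "h x y = cinner (T x) y - cinner x (T y)" for x y
  have diag: "h x x = 0" for x
    using real[of x] cinner_commute[of x "T x"] by (simp add: h_def Reals_cnj_iff)
  have anti: "h x y + h y x = 0" for x y
    using diag[of "x + y"] diag[of x] diag[of y]
    by (simp add: h_def add cinner_add_left cinner_add_right algebra_simps)
  have "\<i> * h x y - \<i> * h y x = 0"
    using anti[of "\<i> *\<^sub>C x" y]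
    by (simp add: h_def C cinner_scaleC_left cinner_scaleC_right algebra_simps)
  then have "h x y = h y x" by simp
  then have "h x y = 0" using anti[of x y] by simp
  then show ?thesis by (simp add: h_def)
qed

text \<open>
  The nonnegative form of \<open>T\<close> at \<open>x - t T x\<close>, with \<open>t = 1/b\<close>, bounds \<open>\<parallel>T x\<parallel>\<^sup>2\<close>. This takes the
  place of the Cauchy-Schwarz inequality for that form. If \<open>b = 0\<close>, then \<open>t = 1\<close> gives \<open>T x = 0\<close>.
\<close>

lemma norm_le_if_between:
  assumes T: "op_between 0 b T" and "0 \<le> b"
  shows "norm (T x) \<le> b * norm x"
proof -
  have add: "\<And>x y. T (x + y) = T x + T y" and C: "\<And>c x. T (c *\<^sub>C x) = c *\<^sub>C T x"
    and pos: "\<And>x. 0 \<le> Re (cinner (T x) x)"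
    and le: "\<And>x. Re (cinner (T x) x) \<le> b * (norm x)\<^sup>2"
    using T by (auto simp: op_between_def)
  have form: "0 \<le> b * (norm x)\<^sup>2 - 2 * t * (norm (T x))\<^sup>2 + t\<^sup>2 * (b * (norm (T x))\<^sup>2)" for t
  proof -
    have scale: "T (r *\<^sub>R x) = r *\<^sub>R T x" for r x
      using C[of "of_real r" x] by (simp only: scaleC_of_real)
    have self: "Re (cinner (T x) (T x)) = (norm (T x))\<^sup>2"
      by (simp only: cinner_self Re_complex_of_real)
    have cross: "Re (cinner (T (T x)) x) = (norm (T x))\<^sup>2"
      unfolding op_between_symmetric[OF T, of "T x" x] by (rule self)
    have "Re (cinner (T (x + (- t) *\<^sub>R T x)) (x + (- t) *\<^sub>R T x))
        = Re (cinner (T x) x) - 2 * t * (norm (T x))\<^sup>2 + t\<^sup>2 * Re (cinner (T (T x)) (T x))"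
      unfolding add scale cinner_add_left cinner_add_right cinner_scaleR_left cinner_scaleR_right
        plus_complex.sel scaleR_complex.sel self cross
      by (simp only: power2_eq_square) algebra
    moreover have "t\<^sup>2 * Re (cinner (T (T x)) (T x)) \<le> t\<^sup>2 * (b * (norm (T x))\<^sup>2)"
      by (intro mult_left_mono le) simp
    ultimately show ?thesis
      using pos[of "x + (- t) *\<^sub>R T x"] le[of x] by linarith
  qed
  have "(norm (T x))\<^sup>2 \<le> (b * norm x)\<^sup>2"
  proof (cases "b = 0")
    case True
    then show ?thesis using form[of 1] by simp
  next
    case False
    then have "0 < b" using \<open>0 \<le> b\<close> by simp
    have "(1 / b)\<^sup>2 * (b * (norm (T x))\<^sup>2) = (norm (T x))\<^sup>2 / b"
      using \<open>0 < b\<close> by (simp add: power2_eq_square)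
    then have "(norm (T x))\<^sup>2 / b \<le> b * (norm x)\<^sup>2"
      using form[of "1 / b"] by simp
    then have "(norm (T x))\<^sup>2 \<le> b * (norm x)\<^sup>2 * b"
      using \<open>0 < b\<close> by (simp only: pos_divide_le_eq)
    also have "\<dots> = (b * norm x)\<^sup>2" by (simp only: power2_eq_square ac_simps)
    finally show ?thesis .
  qed
  then show ?thesis by (rule power2_le_imp_le) (simp add: \<open>0 \<le> b\<close>)
qed

lemma op_between_affine:
  assumes T: "op_between a b T" and "0 \<le> r"
  shows "op_between (s - r * b) (s - r * a) (\<lambda>x. s *\<^sub>R x - r *\<^sub>R T x)"
proof -
  have add: "\<And>x y. T (x + y) = T x + T y" and C: "\<And>c x. T (c *\<^sub>C x) = c *\<^sub>C T x"
    and real: "\<And>x. cinner (T x) x \<in> \<real>"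
    and lo: "\<And>x. a * (norm x)\<^sup>2 \<le> Re (cinner (T x) x)"
    and hi: "\<And>x. Re (cinner (T x) x) \<le> b * (norm x)\<^sup>2"
    using assms by (auto simp: op_between_def)
  have form: "cinner (s *\<^sub>R x - r *\<^sub>R T x) x
      = of_real (s * (norm x)\<^sup>2) - of_real r * cinner (T x) x" for x
    by (simp add: cinner.diff_left cinner_scaleR_left cinner_self scaleR_conv_of_real)
  show ?thesis
    unfolding op_between_def form
  proof (intro conjI allI)
    fix x y :: 'a and c
    show "s *\<^sub>R (x + y) - r *\<^sub>R T (x + y) = s *\<^sub>R x - r *\<^sub>R T x + (s *\<^sub>R y - r *\<^sub>R T y)"
      by (simp add: add algebra_simps)
    show "s *\<^sub>R c *\<^sub>C x - r *\<^sub>R T (c *\<^sub>C x) = c *\<^sub>C (s *\<^sub>R x - r *\<^sub>R T x)"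
      by (simp add: C scaleC_diff_right scaleC_scaleR)
    show "of_real (s * (norm x)\<^sup>2) - of_real r * cinner (T x) x \<in> \<real>"
      using real by simp
    show "(s - r * b) * (norm x)\<^sup>2 \<le> Re (of_real (s * (norm x)\<^sup>2) - of_real r * cinner (T x) x)"
      using mult_left_mono[OF hi[of x] \<open>0 \<le> r\<close>] by (simp add: algebra_simps)
    show "Re (of_real (s * (norm x)\<^sup>2) - of_real r * cinner (T x) x) \<le> (s - r * a) * (norm x)\<^sup>2"
      using mult_left_mono[OF lo[of x] \<open>0 \<le> r\<close>] by (simp add: algebra_simps)
  qed
qed

lemma op_between_bounded_clinear:
  assumes T: "op_between 0 b T" and "0 \<le> b"
  shows "bounded_clinear T"
  unfolding bounded_clinear_def
proof
  have add: "\<And>x y. T (x + y) = T x + T y" and C: "\<And>c x. T (c *\<^sub>C x) = c *\<^sub>C T x"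
    using assms by (auto simp: op_between_def)
  show "bounded_linear T"
    by (rule bounded_linear_intro[where K = b])
       (simp_all add: add C scaleC_of_real[symmetric] norm_le_if_between[OF T \<open>0 \<le> b\<close>] mult.commute)
  show "\<forall>c x. T (c *\<^sub>C x) = c *\<^sub>C T x" using C by blast
qed

section \<open>Coercive operators and their square roots\<close>

text \<open>
  If \<open>a I \<le> S \<le> b I\<close> and \<open>0 < a \<le> b\<close>, the operator \<open>I - S/b\<close> is a strict contraction. It carries both the
  invertibility of \<open>S\<close> and the construction of the square root.
\<close>

lemma coercive_remainder:
  assumes S: "op_between a b S" and "0 < a" "a \<le> b"
  defines "T \<equiv> \<lambda>x. x - (1/b) *\<^sub>R S x"
  shows "op_between 0 (1 - a / b) T" and "0 \<le> 1 - a / b" and "1 - a / b < 1"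
    and "\<And>x. S x = b *\<^sub>R (x - T x)"
  using op_between_affine[OF S, of "1/b" 1] assms by (simp_all add: T_def)

lemma surj_if_coercive:
  fixes S :: "'a::chilbert_space \<Rightarrow> 'a"
  assumes S: "op_between a b S" and ab: "0 < a" "a \<le> b"
  shows "surj S"
proof -
  define T where "T x = x - (1/b) *\<^sub>R S x" for x
  define q where "q = 1 - a / b"
  note rem = coercive_remainder[OF S ab, folded T_def q_def]
  interpret T: bounded_linear T
    using op_between_bounded_clinear[OF rem(1,2)] by (simp add: bounded_clinear_def)
  have "\<exists>x. S x = y" for y
  proof -
    have "\<forall>x z. dist ((1/b) *\<^sub>R y + T x) ((1/b) *\<^sub>R y + T z) \<le> q * dist x z"
      using norm_le_if_between[OF rem(1,2)] by (simp add: dist_norm T.diff[symmetric])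
    from banach_fix_type[OF rem(2,3) this] obtain x where x: "(1/b) *\<^sub>R y + T x = x" by blast
    have "S x = b *\<^sub>R ((1/b) *\<^sub>R y)" unfolding rem(4) using x by (metis add_diff_cancel_right')
    then show ?thesis using ab by auto
  qed
  then show ?thesis unfolding surj_def by metis
qed

text \<open>
  The map \<open>Z \<mapsto> (T + Z\<^sup>2)/2\<close> contracts by the factor \<open>q\<close> on the ball of radius \<open>q\<close>, since
  \<open>Z\<^sup>2 - W\<^sup>2 = Z (Z - W) + (Z - W) W\<close>.
\<close>

lemma quadratic_fixed_point:
  fixes T :: "'a::chilbert_space \<Rightarrow> 'a"
  assumes T: "op_between 0 q T" and q: "0 \<le> q" "q < 1"
  shows "\<exists>Z. bounded_clinear Z \<and> (\<forall>x y. cinner (Z x) y = cinner x (Z y)) \<and>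
    (\<forall>x. norm (Z x) \<le> q * norm x) \<and> (\<forall>x. 2 *\<^sub>R Z x = T x + Z (Z x))"
proof -
  have T_lin: "bounded_linear T" and TC: "\<And>c x. T (c *\<^sub>C x) = c *\<^sub>C T x"
    using op_between_bounded_clinear[OF T q(1)] by (auto simp: bounded_clinear_def)
  define T' where "T' = Blinfun T"
  have T': "blinfun_apply T' = T" unfolding T'_def by (rule bounded_linear_Blinfun_apply[OF T_lin])
  have T'_norm: "norm T' \<le> q"
    by (rule norm_blinfun_bound) (simp_all add: q T' norm_le_if_between[OF T])
  \<comment> \<open>Complex homogeneity and symmetry are closed conditions, so they pass to the fixed point.\<close>
  define D :: "('a \<Rightarrow>\<^sub>L 'a) set" where
    "D = {Z. norm Z \<le> q \<and> (\<forall>c x. blinfun_apply Z (c *\<^sub>C x) = c *\<^sub>C blinfun_apply Z x) \<and>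
      (\<forall>x y. cinner (blinfun_apply Z x) y = cinner x (blinfun_apply Z y))}"
  define f where "f Z = (1/2) *\<^sub>R (T' + (Z o\<^sub>L Z))" for Z :: "'a \<Rightarrow>\<^sub>L 'a"
  have "closed D"
    unfolding D_def
    by (intro closed_Collect_conj closed_Collect_all closed_Collect_eq closed_Collect_le
        continuous_intros cinner.continuous_on bounded_linear.continuous_on[OF bounded_linear_scaleC])
  then have "complete D" by (simp add: complete_eq_closed)
  moreover have "0 \<in> D"
    by (simp add: D_def q linear_0[OF bounded_linear.linear[OF bounded_linear_scaleC]]
        cinner.zero_left cinner.zero_right)
  moreover have "f ` D \<subseteq> D"
  proof clarify
    fix Z assume Z: "Z \<in> D"
    then have Z_norm: "norm Z \<le> q" and ZC: "\<And>c x. Z (c *\<^sub>C x) = c *\<^sub>C Z x"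
      and Z_sym: "\<And>x y. cinner (Z x) y = cinner x (Z y)" by (auto simp: D_def)
    have "norm (T' + (Z o\<^sub>L Z)) \<le> norm T' + norm (Z o\<^sub>L Z)" by (rule norm_triangle_ineq)
    also have "\<dots> \<le> q + norm Z * norm Z" by (intro add_mono T'_norm norm_blinfun_compose)
    \<comment> \<open>The radius \<open>q\<close> is preserved because \<open>(q + q\<^sup>2)/2 \<le> q\<close>.\<close>
    also have "\<dots> \<le> q + 1 * q" using Z_norm q by (intro add_left_mono mult_mono) auto
    finally have "norm (f Z) \<le> q" by (simp add: f_def)
    moreover have "f Z (c *\<^sub>C x) = c *\<^sub>C f Z x" for c x
      by (simp add: f_def blinfun.bilinear_simps T' TC ZC scaleC_add_right scaleC_scaleR)
    moreover have "cinner (f Z x) y = cinner x (f Z y)" for x y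
      by (simp add: f_def blinfun.bilinear_simps T' op_between_symmetric[OF T] Z_sym
          cinner_scaleR_left cinner_scaleR_right cinner_add_left cinner_add_right)
    ultimately show "f Z \<in> D" by (simp add: D_def)
  qed
  moreover have "dist (f Z) (f W) \<le> q * dist Z W" if "Z \<in> D" "W \<in> D" for Z W
  proof -
    have Z_norm: "norm Z \<le> q" and W_norm: "norm W \<le> q" using that by (auto simp: D_def)
    have "f Z - f W = (1/2) *\<^sub>R ((Z o\<^sub>L (Z - W)) + ((Z - W) o\<^sub>L W))"
      by (rule blinfun_eqI) (simp add: f_def blinfun.bilinear_simps algebra_simps)
    then have "norm (f Z - f W) = (1/2) * norm ((Z o\<^sub>L (Z - W)) + ((Z - W) o\<^sub>L W))"
      by simp
    also have "norm ((Z o\<^sub>L (Z - W)) + ((Z - W) o\<^sub>L W)) \<le> norm (Z o\<^sub>L (Z - W)) + norm ((Z - W) o\<^sub>L W)"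
      by (rule norm_triangle_ineq)
    also have "\<dots> \<le> norm Z * norm (Z - W) + norm (Z - W) * norm W"
      by (intro add_mono norm_blinfun_compose)
    also have "\<dots> \<le> q * norm (Z - W) + norm (Z - W) * q"
      by (intro add_mono mult_right_mono mult_left_mono Z_norm W_norm) auto
    finally show ?thesis by (simp add: dist_norm)
  qed
  ultimately obtain Z where Z: "Z \<in> D" "f Z = Z"
    using Banach_fix[of D q f] q by blast
  show ?thesis
  proof (intro exI[of _ "blinfun_apply Z"] conjI allI)
    show "bounded_clinear (blinfun_apply Z)"
      using Z(1) by (simp add: bounded_clinear_def D_def blinfun.bounded_linear_right)
    fix x y
    show "cinner (Z x) y = cinner x (Z y)" using Z(1) by (simp add: D_def)
    show "norm (Z x) \<le> q * norm x"
      using norm_blinfun[of Z x] Z(1) mult_right_mono[of "norm Z" q "norm x"] by (simp add: D_def)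
    have "2 *\<^sub>R Z x = 2 *\<^sub>R f Z x" by (simp add: Z(2))
    also have "\<dots> = T x + Z (Z x)" by (simp add: f_def blinfun.bilinear_simps T')
    finally show "2 *\<^sub>R Z x = T x + Z (Z x)" .
  qed
qed

text \<open>
  The difference of two solutions satisfies \<open>2 (W - Z) = W (W - Z) + (W - Z) Z\<close>. So the norm bound
  needs to be below \<open>1\<close> for one of them only.
\<close>

lemma quadratic_fixed_point_unique:
  fixes W Z T :: "'a::real_normed_vector \<Rightarrow> 'a"
  assumes W: "bounded_linear W" "\<And>x. norm (W x) \<le> norm x" "\<And>x. 2 *\<^sub>R W x = T x + W (W x)"
    and Z: "bounded_linear Z" "\<And>x. norm (Z x) \<le> q * norm x" "\<And>x. 2 *\<^sub>R Z x = T x + Z (Z x)"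
    and q: "0 \<le> q" "q < 1"
  shows "W = Z"
proof -
  define E where "E x = W x - Z x" for x
  have E: "bounded_linear E" unfolding E_def by (intro bounded_linear_sub W Z)
  define N where "N = onorm E"
  have N: "norm (E x) \<le> N * norm x" for x unfolding N_def by (rule onorm[OF E])
  have "0 \<le> N" unfolding N_def by (rule onorm_pos_le[OF E])
  have "norm (E x) \<le> (1 + q) / 2 * N * norm x" for x
  proof -
    have "2 *\<^sub>R E x = W (E x) + E (Z x)"
      unfolding E_def linear_diff[OF bounded_linear.linear[OF W(1)]] scaleR_diff_right W(3) Z(3) by simp
    then have "2 * norm (E x) = norm (W (E x) + E (Z x))"
      by (metis norm_scaleR abs_numeral)
    also have "\<dots> \<le> norm (W (E x)) + norm (E (Z x))" by (rule norm_triangle_ineq)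
    also have "\<dots> \<le> N * norm x + N * (q * norm x)"
      using W(2)[of "E x"] N[of x] N[of "Z x"] mult_left_mono[OF Z(2)[of x] \<open>0 \<le> N\<close>] by linarith
    finally show ?thesis by (simp add: field_simps)
  qed
  then have "onorm E \<le> (1 + q) / 2 * N"
    by (intro onorm_bound) (simp_all add: q \<open>0 \<le> N\<close>)
  then have "N \<le> (1 + q) / 2 * N" by (simp only: N_def)
  then have "(1 - q) * N \<le> 0" by (simp add: field_simps)
  then have "N = 0" using q \<open>0 \<le> N\<close> by (simp add: mult_le_0_iff)
  then show ?thesis using N by (auto simp: E_def)
qed

lemma positive_operator_between:
  assumes P: "positive_operator P" and b: "\<And>x. norm (P x) \<le> b * norm x"
  shows "op_between 0 b P"
proof -
  have "bounded_linear P" and "\<And>c x. P (c *\<^sub>C x) = c *\<^sub>C P x"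
    and "\<And>x. cinner (P x) x \<in> \<real>" and "\<And>x. 0 \<le> Re (cinner (P x) x)"
    using P by (auto simp: positive_operator_def bounded_clinear_def)
  moreover have "Re (cinner (P x) x) \<le> b * (norm x)\<^sup>2" for x
  proof -
    have "Re (cinner (P x) x) \<le> norm (P x) * norm x"
      using complex_Re_le_cmod cinner_Cauchy_Schwarz order_trans by blast
    also have "\<dots> \<le> b * norm x * norm x" by (intro mult_right_mono b) simp
    finally show ?thesis by (simp add: power2_eq_square mult.assoc)
  qed
  ultimately show ?thesis by (simp add: op_between_def bounded_linear.linear linear_add)
qed

lemma positive_operator_symmetric:
  assumes "positive_operator P"
  shows "cinner (P x) y = cinner x (P y)"
proof -
  have "bounded_linear P" using assms by (simp add: positive_operator_def bounded_clinear_def)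
  then obtain M where "\<And>x. norm (P x) \<le> M * norm x"
    using bounded_linear.bounded by (metis mult.commute)
  from positive_operator_between[OF assms this] show ?thesis by (rule op_between_symmetric)
qed

lemma coercive_sqrt:
  fixes S :: "'a::chilbert_space \<Rightarrow> 'a"
  assumes S: "op_between a b S" and ab: "0 < a" "a \<le> b"
  shows "\<exists>!R. positive_operator R \<and> R \<circ> R = S"
proof -
  define T where "T x = x - (1/b) *\<^sub>R S x" for x
  define q where "q = 1 - a / b"
  note rem = coercive_remainder[OF S ab, folded T_def q_def]
  have "0 < b" using ab by simp
  define r where "r = sqrt b"
  have r: "0 < r" "r * r = b" using \<open>0 < b\<close> by (simp_all add: r_def)
  obtain Z where Z: "bounded_clinear Z" "\<And>x y. cinner (Z x) y = cinner x (Z y)"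
      "\<And>x. norm (Z x) \<le> q * norm x" "\<And>x. 2 *\<^sub>R Z x = T x + Z (Z x)"
    using quadratic_fixed_point[OF rem(1-3)] by blast
  have Z_lin: "bounded_linear Z" and ZC: "\<And>c x. Z (c *\<^sub>C x) = c *\<^sub>C Z x"
    using Z(1) by (auto simp: bounded_clinear_def)
  interpret Z: bounded_linear Z by (rule Z_lin)
  define R where "R x = r *\<^sub>R (x - Z x)" for x
  have R_pos: "positive_operator R"
    unfolding positive_operator_def bounded_clinear_def
  proof (intro conjI allI)
    show "bounded_linear R"
      unfolding R_def
      by (intro bounded_linear_const_scaleR bounded_linear_sub bounded_linear_ident Z_lin)
    show "R (c *\<^sub>C x) = c *\<^sub>C R x" for c x
      by (simp add: R_def ZC scaleC_diff_right scaleC_scaleR)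
    fix x
    have form: "cinner (R x) x = of_real r * (of_real ((norm x)\<^sup>2) - cinner (Z x) x)"
      by (simp add: R_def cinner_scaleR_left cinner.diff_left cinner_self scaleR_conv_of_real)
    have "cinner (Z x) x \<in> \<real>"
      using Z(2)[of x x] cinner_commute[of x "Z x"] by (simp add: Reals_cnj_iff)
    then show "cinner (R x) x \<in> \<real>" unfolding form by simp
    have "Re (cinner (Z x) x) \<le> norm (Z x) * norm x"
      using complex_Re_le_cmod cinner_Cauchy_Schwarz order_trans by blast
    also have "\<dots> \<le> (q * norm x) * norm x" by (intro mult_right_mono Z(3)) simp
    also have "\<dots> \<le> 1 * (norm x)\<^sup>2"
      unfolding power2_eq_square mult.assoc using rem(3) by (intro mult_right_mono) auto
    finally show "0 \<le> Re (cinner (R x) x)" using r(1) by (simp add: form)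
  qed
  have R_sq: "R \<circ> R = S"
  proof
    fix x
    have "(R \<circ> R) x = b *\<^sub>R (x - 2 *\<^sub>R Z x + Z (Z x))"
      by (simp add: R_def Z.scaleR Z.diff r(2)[symmetric] algebra_simps scaleR_2)
    also have "\<dots> = S x" unfolding Z(4) rem(4) by simp
    finally show "(R \<circ> R) x = S x" .
  qed
  have unique: "P = R" if P: "positive_operator P" and sq: "P \<circ> P = S" for P
  proof -
    have P_norm: "norm (P x) \<le> r * norm x" for x
    proof -
      have "complex_of_real ((norm (P x))\<^sup>2) = cinner (S x) x"
        unfolding sq[symmetric] by (simp add: positive_operator_symmetric[OF P] cinner_self)
      then have "(norm (P x))\<^sup>2 = Re (cinner (S x) x)" by (metis Re_complex_of_real)
      also have "\<dots> \<le> (r * norm x)\<^sup>2"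
        using S r(2) by (simp add: op_between_def power_mult_distrib power2_eq_square[of r])
      finally show ?thesis by (rule power2_le_imp_le) (use r(1) in simp)
    qed
    \<comment> \<open>The coefficient \<open>1\<close> makes this an instance of \<open>op_between_affine\<close>.\<close>
    define W where "W x = 1 *\<^sub>R x - (1/r) *\<^sub>R P x" for x
    have "op_between (1 - (1/r) * r) (1 - (1/r) * 0) W"
      unfolding W_def
      by (intro op_between_affine positive_operator_between[OF P P_norm]) (use r(1) in simp)
    then have W: "op_between 0 1 W" using r(1) by simp
    interpret P: bounded_linear P
      using P by (simp add: positive_operator_def bounded_clinear_def)
    have "W = Z"
    proof (rule quadratic_fixed_point_unique)
      show "bounded_linear W"
        using op_between_bounded_clinear[OF W] by (simp add: bounded_clinear_def)
      show "norm (W x) \<le> norm x" for x using norm_le_if_between[OF W] by simp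
      fix x
      have "P (P x) = S x" using sq by (metis comp_apply)
      then have "W (W x) = x - 2 *\<^sub>R ((1/r) *\<^sub>R P x) + (1/b) *\<^sub>R S x"
        by (simp add: W_def P.diff P.scaleR r(2)[symmetric] algebra_simps)
           (simp flip: scaleR_add_left)
      then show "2 *\<^sub>R W x = T x + W (W x)"
        by (simp add: W_def T_def algebra_simps scaleR_2)
    qed (use Z_lin Z(3,4) rem(2,3) in auto)
    show "P = R"
    proof
      fix x
      have "R x = r *\<^sub>R (x - W x)" by (simp add: R_def \<open>W = Z\<close>)
      also have "\<dots> = P x" using r(1) by (simp add: W_def)
      finally show "P x = R x" by simp
    qed
  qed
  show ?thesis using R_pos R_sq unique by blast
qed

text \<open>The easy case of Douglas factorisation, in which the left factor has a bounded inverse.\<close>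

lemma factor_through:
  fixes R K :: "'a::complex_inner \<Rightarrow> 'a"
  assumes R: "bounded_clinear R" "surj R" and c: "0 < c" "\<And>x. c * norm x \<le> norm (R x)"
    and K: "bounded_clinear K"
  shows "\<exists>U. bounded_clinear U \<and> K = R \<circ> U"
proof -
  have R_lin: "bounded_linear R" and RC: "\<And>c x. R (c *\<^sub>C x) = c *\<^sub>C R x"
    using R(1) by (auto simp: bounded_clinear_def)
  have K_lin: "bounded_linear K" and KC: "\<And>c x. K (c *\<^sub>C x) = c *\<^sub>C K x"
    using K by (auto simp: bounded_clinear_def)
  interpret R: bounded_linear R by (rule R_lin)
  interpret K: bounded_linear K by (rule K_lin)
  have inj: "x = y" if "R x = R y" for x y
  proof -
    have "c * norm (x - y) \<le> 0" using c(2)[of "x - y"] that by (simp add: R.diff)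
    then show ?thesis using c(1) by (simp add: mult_le_0_iff)
  qed
  define U where "U = inv R \<circ> K"
  have U: "R (U x) = K x" for x unfolding U_def using R(2) by (simp add: surj_f_inv_f)
  obtain M where M: "\<And>x. norm (K x) \<le> norm x * M" using K.bounded by blast
  have "bounded_clinear U"
    unfolding bounded_clinear_def
  proof (intro conjI allI)
    show "bounded_linear U"
    proof (rule bounded_linear_intro)
      show "U (x + y) = U x + U y" for x y by (rule inj) (simp add: U R.add K.add)
      show "U (t *\<^sub>R x) = t *\<^sub>R U x" for t x by (rule inj) (simp add: U R.scaleR K.scaleR)
      show "norm (U x) \<le> norm x * (M / c)" for x
      proof -
        have "c * norm (U x) \<le> norm x * M" using c(2)[of "U x"] M[of x] by (simp add: U)
        then show ?thesis using c(1) by (simp add: field_simps)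
      qed
    qed
    show "U (t *\<^sub>C x) = t *\<^sub>C U x" for t x by (rule inj) (simp add: U RC KC)
  qed
  moreover have "K = R \<circ> U" by (rule ext) (simp add: U)
  ultimately show ?thesis by blast
qed

section \<open>Biframes\<close>

lemma biframe_operator_form_sums:
  assumes "is_biframe_operator X Y S"
  shows "(\<lambda>i. cinner x (X i) * cinner (Y i) x) sums cinner (S x) x"
  using assms
    bounded_linear.sums[OF cinner.bounded_linear_left, of "\<lambda>i. cinner x (X i) *\<^sub>C Y i" "S x" x]
  by (simp add: is_biframe_operator_def cinner_scaleC_left)

lemma biframe_operator_between:
  fixes X Y :: "nat \<Rightarrow> 'a::chilbert_space"
  assumes "biframe X Y" and S: "is_biframe_operator X Y S"
  shows "\<exists>A B. 0 < A \<and> A \<le> B \<and> op_between A B S"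
proof -
  obtain A B where AB: "0 < A" "A \<le> B"
    and bounds: "\<And>x. \<exists>s::real. (\<lambda>i. cinner x (X i) * cinner (Y i) x) sums complex_of_real s \<and>
        A * (norm x)\<^sup>2 \<le> s \<and> s \<le> B * (norm x)\<^sup>2"
    using assms(1) unfolding biframe_def K_biframe_def cadjoint_id id_apply by blast
  have S_sums: "(\<lambda>i. cinner x (X i) *\<^sub>C Y i) sums S x" for x
    using S by (simp add: is_biframe_operator_def)
  have "S (x + y) = S x + S y" for x y
  proof -
    have "(\<lambda>i. cinner (x + y) (X i) *\<^sub>C Y i) sums (S x + S y)"
      using sums_add[OF S_sums[of x] S_sums[of y]] by (simp add: cinner_add_left scaleC_add_left)
    then show ?thesis using S_sums sums_unique2 by blast
  qed
  moreover have "S (c *\<^sub>C x) = c *\<^sub>C S x" for c x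
  proof -
    have "(\<lambda>i. cinner (c *\<^sub>C x) (X i) *\<^sub>C Y i) sums (c *\<^sub>C S x)"
      using bounded_linear.sums[OF bounded_linear_scaleC S_sums[of x], of c]
      by (simp add: cinner_scaleC_left scaleC_scaleC)
    then show ?thesis using S_sums sums_unique2 by blast
  qed
  moreover have "cinner (S x) x \<in> \<real> \<and>
      A * (norm x)\<^sup>2 \<le> Re (cinner (S x) x) \<and> Re (cinner (S x) x) \<le> B * (norm x)\<^sup>2" for x
  proof -
    obtain s :: real where s: "(\<lambda>i. cinner x (X i) * cinner (Y i) x) sums complex_of_real s"
        "A * (norm x)\<^sup>2 \<le> s" "s \<le> B * (norm x)\<^sup>2"
      using bounds by blast
    have "cinner (S x) x = complex_of_real s"
      by (rule sums_unique2[OF biframe_operator_form_sums[OF S] s(1)])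
    then show ?thesis using s(2,3) by simp
  qed
  ultimately have "op_between A B S" by (simp add: op_between_def)
  then show ?thesis using AB by blast
qed

lemma biframe_imp_K_biframe:
  fixes X Y :: "nat \<Rightarrow> 'a::chilbert_space"
  assumes "biframe X Y" and K: "bounded_clinear K"
  shows "K_biframe K X Y"
proof -
  obtain A B where AB: "0 < A" "A \<le> B"
    and bounds: "\<And>x. \<exists>s::real. (\<lambda>i. cinner x (X i) * cinner (Y i) x) sums complex_of_real s \<and>
        A * (norm x)\<^sup>2 \<le> s \<and> s \<le> B * (norm x)\<^sup>2"
    using assms(1) unfolding biframe_def K_biframe_def cadjoint_id id_apply by blast
  have "bounded_linear K" using K by (simp add: bounded_clinear_def)
  then obtain M where M: "0 \<le> M" "\<And>x. norm (K x) \<le> M * norm x"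
    using bounded_linear.nonneg_bounded by (metis mult.commute)
  \<comment> \<open>The summand \<open>1\<close> covers \<open>M = 0\<close> and gives \<open>A' \<le> A \<le> B\<close>.\<close>
  define A' where "A' = A / (M\<^sup>2 + 1)"
  have "0 < M\<^sup>2 + 1" by (simp add: add_nonneg_pos)
  then have A'_pos: "0 < A'" using AB by (simp add: A'_def)
  have "A * 1 \<le> A * (M\<^sup>2 + 1)" using AB by (intro mult_left_mono) auto
  then have "A' \<le> A" using \<open>0 < M\<^sup>2 + 1\<close> by (simp add: A'_def pos_divide_le_eq)
  have lower: "A' * (norm (cadjoint K x))\<^sup>2 \<le> A * (norm x)\<^sup>2" for x
  proof -
    have "(norm (cadjoint K x))\<^sup>2 \<le> (M * norm x)\<^sup>2"
      by (intro power_mono norm_cadjoint_le[OF K M]) simp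
    also have "\<dots> \<le> (M\<^sup>2 + 1) * (norm x)\<^sup>2" by (simp add: power_mult_distrib distrib_right)
    finally have "A' * (norm (cadjoint K x))\<^sup>2 \<le> A' * ((M\<^sup>2 + 1) * (norm x)\<^sup>2)"
      using A'_pos by (intro mult_left_mono) auto
    also have "\<dots> = A * (norm x)\<^sup>2" using \<open>0 < M\<^sup>2 + 1\<close> by (simp add: A'_def)
    finally show ?thesis .
  qed
  show ?thesis
    unfolding K_biframe_def
  proof (rule exI[of _ A'], rule exI[of _ B], intro conjI allI)
    show "0 < A'" by (rule A'_pos)
    show "A' \<le> B" using \<open>A' \<le> A\<close> AB by simp
    fix x
    show "\<exists>s::real. (\<lambda>i. cinner x (X i) * cinner (Y i) x) sums complex_of_real s \<and>
        A' * (norm (cadjoint K x))\<^sup>2 \<le> s \<and> s \<le> B * (norm x)\<^sup>2"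
      using bounds[of x] lower[of x] order_trans by blast
  qed
qed

lemma factor_through_biframe_sqrt:
  fixes X Y :: "nat \<Rightarrow> 'a::chilbert_space" and K :: "'a \<Rightarrow> 'a"
  assumes "biframe X Y" and "is_biframe_operator X Y S" and K: "bounded_clinear K"
  shows "\<exists>U. bounded_clinear U \<and> K = operator_sqrt S \<circ> U"
proof -
  obtain A B where AB: "0 < A" "A \<le> B" and S: "op_between A B S"
    using biframe_operator_between[OF assms(1,2)] by blast
  define R where "R = operator_sqrt S"
  have "positive_operator R \<and> R \<circ> R = S"
    unfolding R_def operator_sqrt_def by (rule theI'[OF coercive_sqrt[OF S AB]])
  then have R_pos: "positive_operator R" and R_sq: "R \<circ> R = S" by simp_all
  have "surj (R \<circ> R)" unfolding R_sq by (rule surj_if_coercive[OF S AB])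
  then have "surj R" unfolding surj_def comp_def by metis
  have "sqrt A * norm x \<le> norm (R x)" for x
  proof -
    have "complex_of_real ((norm (R x))\<^sup>2) = cinner (S x) x"
      unfolding R_sq[symmetric] by (simp add: positive_operator_symmetric[OF R_pos] cinner_self)
    then have "Re (cinner (S x) x) = (norm (R x))\<^sup>2" by (metis Re_complex_of_real)
    moreover have "A * (norm x)\<^sup>2 \<le> Re (cinner (S x) x)"
      using S unfolding op_between_def by blast
    ultimately have "(sqrt A * norm x)\<^sup>2 \<le> (norm (R x))\<^sup>2"
      using AB(1) by (simp add: power_mult_distrib)
    then show ?thesis by (rule power2_le_imp_le) simp
  qed
  then show ?thesis
    unfolding R_def[symmetric]
    using factor_through[of R "sqrt A" K] R_pos \<open>surj R\<close> AB K
    by (simp add: positive_operator_def)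
qed

theorem theorem3p12:
  fixes K S :: "'h::chilbert_space \<Rightarrow> 'h"
    and X Y :: "nat \<Rightarrow> 'h"
  assumes "separable_space (euclidean :: 'h topology)"
    and "bounded_clinear K"
    and "biframe X Y"
    and "is_biframe_operator X Y S"
    and "cadjoint (operator_sqrt S) = operator_sqrt S"
  shows "K_biframe K X Y \<longleftrightarrow>
    (\<exists>U. bounded_clinear U \<and> K = operator_sqrt S \<circ> U)"
  using biframe_imp_K_biframe[OF assms(3,2)] factor_through_biframe_sqrt[OF assms(3,4,2)] by blast

end
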